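(* Let $G$ be a finite abelian group of order $n$ and let $\mathfrak T=(n_1,\dots,n_t)$ be a tower type of degree $n$. Then the flag type $T(\mathfrak T)$ is realizable for $G$ (i.e. there is a flag $\mathcal F$ of $G$ with $T_{\mathcal F}=T(\mathfrak T)$) if and only if $G$ has a filtration by subgroups \[\{1\}=G_0\subset G_1\subset\cdots\subset G_t=G\] such that $G_i/G_{i-1}$ is cyclic of order $n_i$ for all $1\le i\le t$.
   Context: For a positive integer $n$ let $[n]=\{0,\dots,n-1\}$. For a finite abelian group $G$ (written multiplicatively) of order $n$, a flag of $G$ is an indexed family $\mathcal F=\{F_i\}_{i\in[n]}$ of subsets with $\{1\}=F_0\subset F_1\subset\cdots\subset F_{n-1}=G$ and $|F_i|=i+1$. Its flag type is $T_{\mathcal F}:[n]\times[n]\to[n]$, $T_{\mathcal F}(i,j)=\min\{k\in[n]: F_iF_j\subseteq F_k\}$, where $F_iF_j=\{ab: a\in F_i, b\in F_j\}$. A tower type of degree $n$ is a tuple $(n_1,\dots,n_t)$ of integers $>1$ with $n_1\cdots n_t=n$. Every $i\in[n]$ can be written uniquely in mixed radix notation as $i=i_1+i_2n_1+i_3n_1n_2+\cdots+i_tn_1\cdots n_{t-1}$ with $0\le i_s<n_s$. Let $H=C_{n_1}\times\cdots\times C_{n_t}$ (product of cyclic groups), $e_s$ a generator of the $s$-th factor, $v_i=e_1^{i_1}\cdots e_t^{i_t}$ and $F_i=\{v_0,\dots,v_i\}$; $T(\mathfrak T)$ denotes the flag type of this flag of $H$. *)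

theory Defs
  imports "HOL-Algebra.Algebra"
begin

text \<open>A flag is a family \<open>F :: nat \<Rightarrow> 'a set\<close>; only its values on \<open>{..<order G}\<close> matter.\<close>

definition flag :: "('a, 'b) monoid_scheme \<Rightarrow> (nat \<Rightarrow> 'a set) \<Rightarrow> bool" where
  "flag G F \<longleftrightarrow>
     F 0 = {\<one>\<^bsub>G\<^esub>} \<and> F (order G - 1) = carrier G \<and>
     (\<forall>i. Suc i < order G \<longrightarrow> F i \<subset> F (Suc i)) \<and>
     (\<forall>i < order G. card (F i) = i + 1)"

definition flag_type :: "('a, 'b) monoid_scheme \<Rightarrow> (nat \<Rightarrow> 'a set) \<Rightarrow> nat \<Rightarrow> nat \<Rightarrow> nat" where
  "flag_type G F i j = (LEAST k. k < order G \<and> F i <#>\<^bsub>G\<^esub> F j \<subseteq> F k)"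

text \<open>Flag types are functions on \<open>[n] \<times> [n]\<close>, so they are compared there only.\<close>

definition realizable :: "('a, 'b) monoid_scheme \<Rightarrow> (nat \<Rightarrow> nat \<Rightarrow> nat) \<Rightarrow> bool" where
  "realizable G T \<longleftrightarrow>
     (\<exists>F. flag G F \<and> (\<forall>i < order G. \<forall>j < order G. flag_type G F i j = T i j))"

text \<open>A tuple \<open>(n\<^sub>1, \<dots>, n\<^sub>t)\<close> is a list \<open>ns\<close> with 0-based positions: \<open>ns ! s\<close> is \<open>n\<^bsub>s+1\<^esub>\<close>.
  The empty tuple is the tower type of degree 1.\<close>

definition tower_type :: "nat \<Rightarrow> nat list \<Rightarrow> bool" where
  "tower_type n ns \<longleftrightarrow> (\<forall>m \<in> set ns. 1 < m) \<and> prod_list ns = n"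

text \<open>Mixed radix digits in closed form; the lemmas below show that they are the unique ones
  with \<open>i = i\<^sub>1 + i\<^sub>2 n\<^sub>1 + \<dots> + i\<^sub>t n\<^sub>1 \<cdots> n\<^bsub>t-1\<^esub>\<close> and \<open>0 \<le> i\<^sub>s < n\<^sub>s\<close>.\<close>

definition digit :: "nat list \<Rightarrow> nat \<Rightarrow> nat \<Rightarrow> nat" where
  "digit ns i s = (i div prod_list (take s ns)) mod (ns ! s)"

lemma digit_less:
  assumes "tower_type n ns" "s < length ns"
  shows "digit ns i s < ns ! s"
proof -
  have "1 < ns ! s"
    using assms nth_mem[of s ns] unfolding tower_type_def by blast
  then show ?thesis
    by (simp add: digit_def)
qed

lemma prod_list_take_Suc:
  fixes ns :: "nat list"
  shows "s < length ns \<Longrightarrow> prod_list (take (Suc s) ns) = prod_list (take s ns) * ns ! s"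
  by (simp add: take_Suc_conv_app_nth)

lemma digit_partial_sum:
  assumes "r \<le> length ns"
  shows "(\<Sum>s<r. digit ns i s * prod_list (take s ns)) = i mod prod_list (take r ns)"
  using assms
proof (induction r)
  case 0
  then show ?case by simp
next
  case (Suc r)
  then show ?case
    by (simp add: prod_list_take_Suc digit_def mod_mult2_eq mult.commute[of "_ mod _"] add.commute)
qed

lemma digit_sum:
  assumes "tower_type n ns" "i < n"
  shows "i = (\<Sum>s<length ns. digit ns i s * prod_list (take s ns))"
  using digit_partial_sum[of "length ns" ns i] assms by (simp add: tower_type_def)

lemma digit_unique:
  assumes "tower_type n ns"
    and "\<And>s. s < length ns \<Longrightarrow> d s < ns ! s"
    and "i = (\<Sum>s<length ns. d s * prod_list (take s ns))"
    and "s < length ns"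
  shows "d s = digit ns i s"
proof -
  have pos: "0 < prod_list (take r ns)" if "r \<le> length ns" for r
    using that
  proof (induction r)
    case 0
    then show ?case by simp
  next
    case (Suc r)
    then have "0 < ns ! r"
      using assms(2)[of r] by auto
    with Suc show ?case by (simp add: prod_list_take_Suc)
  qed
  define P where "P r = (\<Sum>s<r. d s * prod_list (take s ns))" for r
  have lt: "P r < prod_list (take r ns)" if "r \<le> length ns" for r
    using that
  proof (induction r)
    case 0
    then show ?case by (simp add: P_def)
  next
    case (Suc r)
    have "P (Suc r) < prod_list (take r ns) + d r * prod_list (take r ns)"
      using Suc by (simp add: P_def)
    also have "\<dots> = Suc (d r) * prod_list (take r ns)" by simp
    also have "\<dots> \<le> ns ! r * prod_list (take r ns)"
      using assms(2)[of r] Suc.prems by (intro mult_right_mono) auto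
    finally show ?case
      using Suc.prems by (simp add: prod_list_take_Suc mult.commute)
  qed
  have ex: "\<exists>q. P r' = P r + q * prod_list (take r ns)" if "r \<le> r'" "r' \<le> length ns" for r r'
    using that
  proof (induction r' rule: dec_induct)
    case base
    then show ?case by (intro exI[of _ 0]) simp
  next
    case (step m)
    then obtain q where q: "P m = P r + q * prod_list (take r ns)" by auto
    have "take m ns = take r ns @ drop r (take m ns)"
      using step.hyps by (metis append_take_drop_id min.absorb1 take_take)
    then have "prod_list (take m ns) = prod_list (take r ns) * prod_list (drop r (take m ns))"
      by (metis prod_list.append)
    then have "P (Suc m) = P r + (q + d m * prod_list (drop r (take m ns))) * prod_list (take r ns)"
      using q by (simp add: P_def algebra_simps)
    then show ?case by blast
  qed
  obtain q where q: "P (length ns) = P (Suc s) + q * prod_list (take (Suc s) ns)"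
    using ex[of "Suc s" "length ns"] assms(4) by auto
  let ?p = "prod_list (take s ns)"
  have "i = P s + (d s + q * ns ! s) * ?p"
    using q assms(3,4) by (simp add: P_def prod_list_take_Suc algebra_simps)
  then have "i div ?p = d s + q * ns ! s"
    using lt[of s] pos[of s] assms(4) by simp
  then show ?thesis
    using assms(2)[OF assms(4)] by (simp add: digit_def)
qed

definition tower_group :: "nat list \<Rightarrow> (nat \<Rightarrow> int) monoid" where
  "tower_group ns = product_group {..<length ns} (\<lambda>s. integer_mod_group (ns ! s))"

text \<open>The generators of the cyclic factors are arbitrary: \<open>e s\<close> generates the \<open>s\<close>-th factor, and
  \<open>factor_emb\<close> is the inclusion of that factor into the product.\<close>

definition tower_gens :: "nat list \<Rightarrow> (nat \<Rightarrow> int) \<Rightarrow> bool" where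
  "tower_gens ns e \<longleftrightarrow>
     (\<forall>s < length ns. e s \<in> carrier (integer_mod_group (ns ! s)) \<and>
        subgroup_generated (integer_mod_group (ns ! s)) {e s} = integer_mod_group (ns ! s))"

definition factor_emb :: "nat list \<Rightarrow> nat \<Rightarrow> int \<Rightarrow> nat \<Rightarrow> int" where
  "factor_emb ns s x =
     (\<lambda>r \<in> {..<length ns}. if r = s then x else \<one>\<^bsub>integer_mod_group (ns ! r)\<^esub>)"

definition tower_elem :: "nat list \<Rightarrow> (nat \<Rightarrow> int) \<Rightarrow> nat \<Rightarrow> nat \<Rightarrow> int" where
  "tower_elem ns e i =
     (\<Otimes>\<^bsub>tower_group ns\<^esub>s \<in> {..<length ns}.
        factor_emb ns s (e s) [^]\<^bsub>tower_group ns\<^esub> digit ns i s)"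

definition tower_flag :: "nat list \<Rightarrow> (nat \<Rightarrow> int) \<Rightarrow> nat \<Rightarrow> (nat \<Rightarrow> int) set" where
  "tower_flag ns e i = tower_elem ns e ` {..i}"

definition tower_flag_type :: "nat list \<Rightarrow> (nat \<Rightarrow> int) \<Rightarrow> nat \<Rightarrow> nat \<Rightarrow> nat" where
  "tower_flag_type ns e = flag_type (tower_group ns) (tower_flag ns e)"

definition cyclic_filtration ::
    "('a, 'b) monoid_scheme \<Rightarrow> nat list \<Rightarrow> (nat \<Rightarrow> 'a set) \<Rightarrow> bool" where
  "cyclic_filtration G ns S \<longleftrightarrow>
     S 0 = {\<one>\<^bsub>G\<^esub>} \<and> S (length ns) = carrier G \<and>
     (\<forall>i \<le> length ns. subgroup (S i) G) \<and>
     (\<forall>i < length ns. S i \<subset> S (Suc i) \<and>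
        cyclic_group (G\<lparr>carrier := S (Suc i)\<rparr> Mod S i) \<and>
        order (G\<lparr>carrier := S (Suc i)\<rparr> Mod S i) = ns ! i)"

end

theory Submission
  imports Defs
begin

text \<open>
  Fix elements \<open>x\<^sub>s\<close> of an abelian group such that each \<open>x\<^sub>s ^ n\<^sub>s\<close> lies in the set of products of
  powers of the earlier ones, and order the products \<open>\<Prod>\<^sub>s x\<^sub>s ^ i\<^sub>s\<close> by mixed radix. Two initial segments
  of this order then multiply to an initial segment, whose length depends on the tower type only: by
  induction on the top digit, if the top digits of \<open>i\<close> and \<open>j\<close> add up without carry then the product
  consists of all lower blocks and of a product one level down, and if there is a carry then it is
  everything. Hence all groups with a suitable filtration realize the type of the product group.

  Conversely, let \<open>F\<close> be a flag of the given type, let \<open>p\<close> be a partial product of the tower type and \<open>n\<close>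
  the next entry. Then \<open>A = F\<^bsub>p-1\<^esub>\<close> is closed under multiplication, so it is a subgroup. For \<open>y \<in> F\<^sub>p\<close>
  outside \<open>A\<close> the values \<open>T(kp-1, 2p-1) = (k+1)p-1\<close> for \<open>0 < k < n\<close> force
  \<open>F\<^bsub>kp-1\<^esub> = A \<union> Ay \<union> \<dots> \<union> Ay\<^bsup>k-1\<^esup>\<close> for \<open>k \<le> n\<close>: were \<open>y\<^sup>k\<close> already in this set, multiplying by
  \<open>F\<^bsub>2p-1\<^esub>\<close> would not enlarge it. So \<open>F\<^bsub>np-1\<^esub> / A\<close> is cyclic, generated by \<open>y\<close>.
\<close>

subsection \<open>Mixed radix arithmetic\<close>

abbreviation place_value :: "nat list \<Rightarrow> nat \<Rightarrow> nat" where
  "place_value ns r \<equiv> prod_list (take r ns)"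

lemma place_value_pos:
  assumes "\<forall>m\<in>set ns. 1 < m"
  shows "0 < place_value ns r"
  using assms by (metis gr0I in_set_takeD not_less_zero prod_list_zero_iff)

lemma block_div_mod:
  fixes c k p :: nat
  assumes "k < p"
  shows "(c * p + k) div p = c" "(c * p + k) mod p = k"
  using assms by simp_all

lemma place_value_dvd:
  assumes "s \<le> r"
  shows "place_value ns s dvd place_value ns r"
proof -
  have "take r ns = take s ns @ drop s (take r ns)"
    using assms by (metis append_take_drop_id min.absorb1 take_take)
  then show ?thesis
    by (metis dvd_triv_left prod_list.append)
qed

lemma less_place_value_SucD:
  assumes "i < place_value ns (Suc r)" "r < length ns"
  shows "i div place_value ns r < ns ! r"
  using assms by (simp add: prod_list_take_Suc less_mult_imp_div_less mult.commute)

lemma block_less: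
  fixes c k p :: nat
  assumes "c < n" "k < p"
  shows "c * p + k < n * p"
proof -
  have "c * p + k < Suc c * p" using assms by simp
  also have "\<dots> \<le> n * p" using assms by (intro mult_right_mono) auto
  finally show ?thesis .
qed

text \<open>Since \<open>place_value ns (Suc s)\<close> divides \<open>place_value ns r\<close>, the
  added block contributes a multiple of \<open>ns ! s\<close> after division by
  \<open>place_value ns s\<close>.\<close>

lemma digit_add_block:
  assumes "s < r" "r \<le> length ns" "\<forall>m\<in>set ns. 1 < m"
  shows "digit ns (c * place_value ns r + k) s = digit ns k s"
proof -
  obtain q where "place_value ns r = place_value ns (Suc s) * q"
    using place_value_dvd[OF Suc_leI[OF assms(1)]] by blast
  then have q: "place_value ns r = place_value ns s * (ns ! s * q)"
    using assms by (simp add: prod_list_take_Suc)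
  have "c * place_value ns r + k = k + place_value ns s * (ns ! s * (q * c))"
    unfolding q by (simp add: algebra_simps)
  then have "(c * place_value ns r + k) div place_value ns s
      = ns ! s * (q * c) + k div place_value ns s"
    using place_value_pos[OF assms(3), of s] by (metis div_mult_self2 less_not_refl)
  then show ?thesis
    by (simp add: digit_def)
qed

text \<open>A group-free formula for the flag type of a tower, peeled from the top digit. When the
  top digits produce a carry, the product of the two segments is the whole level, hence the value at
  the last index.\<close>

primrec radix_type :: "nat list \<Rightarrow> nat \<Rightarrow> nat \<Rightarrow> nat \<Rightarrow> nat" where
  "radix_type ns 0 i j = 0"
| "radix_type ns (Suc r) i j =
    (let p = place_value ns r; c = i div p + j div p
     in if ns ! r \<le> c then ns ! r * p - 1 else c * p + radix_type ns r (i mod p) (j mod p))"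

lemma radix_type_less:
  assumes ns: "\<forall>m\<in>set ns. 1 < m" and "r \<le> length ns"
  shows "radix_type ns r i j < place_value ns r"
  using assms(2)
proof (induction r arbitrary: i j)
  case (Suc r)
  then have "0 < ns ! r * place_value ns r"
    using ns place_value_pos[OF ns] nth_mem[of r ns] by fastforce
  moreover have "radix_type ns r i' j' < place_value ns r" for i' j'
    using Suc by simp
  ultimately show ?case
    using Suc.prems block_less[of _ "ns ! r"]
    by (simp add: Let_def prod_list_take_Suc mult.commute[of "place_value ns r"])
qed simp

text \<open>Both indices have only zero digits above level \<open>r\<close>, so the recursion passes
  these levels unchanged. Values can thus be computed at the lowest convenient level.\<close>

lemma radix_type_level:
  assumes ns: "\<forall>m\<in>set ns. 1 < m" and "r \<le> t" "t \<le> length ns"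
    and ij: "i < place_value ns r" "j < place_value ns r"
  shows "radix_type ns t i j = radix_type ns r i j"
  using assms(2,3)
proof (induction t rule: dec_induct)
  case (step m)
  have "place_value ns r \<le> place_value ns m"
    using place_value_dvd[OF step(1)] place_value_pos[OF ns] dvd_imp_le by blast
  then have "i < place_value ns m" "j < place_value ns m" using ij by auto
  moreover have "0 < ns ! m" using ns step nth_mem[of m ns] by fastforce
  ultimately show ?case using step by simp
qed simp

text \<open>The top digit of the last index is one less than the radix \<open>n\<close>, and
  \<open>2 * (n - 1) \<ge> n\<close> because \<open>n > 1\<close>, so a carry occurs at every level.
  This is what makes levels closed under multiplication.\<close>

lemma radix_type_last:
  assumes ns: "\<forall>m\<in>set ns. 1 < m" and "r \<le> length ns"
  shows "radix_type ns r (place_value ns r - 1) (place_value ns r - 1) = place_value ns r - 1"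
  using assms(2)
proof (induction r)
  case (Suc r)
  let ?p = "place_value ns r" and ?n = "ns ! r"
  have p: "0 < ?p" by (rule place_value_pos[OF ns])
  have n: "1 < ?n" using ns Suc.prems nth_mem[of r ns] by fastforce
  have "?n * ?p - 1 = (?n - 1) * ?p + (?p - 1)"
    using n p by (cases ?n) auto
  then have "(?n * ?p - 1) div ?p = ?n - 1"
    using block_div_mod(1)[of "?p - 1" ?p "?n - 1"] p by simp
  with n show ?case
    using Suc.prems by (simp add: prod_list_take_Suc mult.commute Let_def)
qed simp

text \<open>The top digits \<open>k - 1\<close> and \<open>1\<close> add to
  \<open>k < ns ! r\<close> without carry, and both remainders are the last index of the level
  below.\<close>

lemma radix_type_blocks:
  assumes ns: "\<forall>m\<in>set ns. 1 < m" and "r < length ns" and k: "0 < k" "k < ns ! r"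
  defines "p \<equiv> place_value ns r"
  shows "radix_type ns (Suc r) (k * p - 1) (2 * p - 1) = Suc k * p - 1"
proof -
  have p: "0 < p" unfolding p_def by (rule place_value_pos[OF ns])
  have "k * p - 1 = (k - 1) * p + (p - 1)" "2 * p - 1 = 1 * p + (p - 1)"
    using k p by (cases k; auto)+
  then have "(k * p - 1) div p = k - 1" "(k * p - 1) mod p = p - 1"
     "(2 * p - 1) div p = 1" "(2 * p - 1) mod p = p - 1"
    using block_div_mod[of "p - 1" p] p by (metis diff_less zero_less_one)+
  moreover have "radix_type ns r (p - 1) (p - 1) = p - 1"
    unfolding p_def using radix_type_last[OF ns, of r] assms(2) by simp
  ultimately show ?thesis
    using k p by (simp add: p_def[symmetric] add.commute)
qed

subsection \<open>Mixed radix enumerations of abelian groups\<close>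

text \<open>The product over the first \<open>r\<close> digits, written recursively to suit
  inductions on the level; \<open>radix_elem_eq_finprod\<close> links it to the finite
  product.\<close>

primrec radix_elem :: "('a, 'b) monoid_scheme \<Rightarrow> nat list \<Rightarrow> (nat \<Rightarrow> 'a) \<Rightarrow> nat \<Rightarrow> nat \<Rightarrow> 'a" where
  "radix_elem G ns x 0 i = \<one>\<^bsub>G\<^esub>"
| "radix_elem G ns x (Suc r) i = radix_elem G ns x r i \<otimes>\<^bsub>G\<^esub> x r [^]\<^bsub>G\<^esub> digit ns i r"

text \<open>For a subgroup \<open>A\<close> this is a union of cosets of consecutive powers of
  \<open>y\<close>. It describes both the levels of an enumeration and members of a flag.\<close>

definition power_cosets :: "('a, 'b) monoid_scheme \<Rightarrow> 'a set \<Rightarrow> 'a \<Rightarrow> nat \<Rightarrow> 'a set" where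
  "power_cosets G A y k = {a \<otimes>\<^bsub>G\<^esub> y [^]\<^bsub>G\<^esub> c | a c. a \<in> A \<and> c < k}"

text \<open>The condition on powers is left to \<open>radix_system\<close>: for a filtration it can
  be checked only once the levels have been identified with the given subgroups.\<close>

locale radix_frame = comm_group G for G :: "('a, 'b) monoid_scheme" (structure) +
  fixes ns :: "nat list" and x :: "nat \<Rightarrow> 'a"
  assumes ns: "\<forall>m\<in>set ns. 1 < m"
    and x_closed: "\<And>s. s < length ns \<Longrightarrow> x s \<in> carrier G"
begin

abbreviation "E \<equiv> radix_elem G ns x"

abbreviation "P \<equiv> place_value ns"

lemma radix_elem_closed: "r \<le> length ns \<Longrightarrow> E r i \<in> carrier G"
  by (induction r) (auto simp: x_closed)

lemma radix_elem_0: "E r 0 = \<one>"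
  by (induction r) (auto simp: digit_def)

lemma radix_elem_add_block:
  assumes "r \<le> length ns" "s \<le> r"
  shows "E s (c * P r + k) = E s k"
  using assms(2)
proof (induction s)
  case (Suc s)
  then show ?case using digit_add_block[of s r ns c k] assms(1) ns by simp
qed simp

lemma radix_elem_Suc_block:
  assumes "r < length ns" "c < ns ! r" "k < P r"
  shows "E (Suc r) (c * P r + k) = E r k \<otimes> x r [^] c"
  using assms radix_elem_add_block[of r r c k] by (simp add: digit_def)

text \<open>Division by \<open>P r\<close> splits an index into its top digit, the exponent of
  \<open>x r\<close>, and an index of the level below.\<close>

lemma radix_elem_image_Suc:
  assumes r: "r < length ns"
  shows "E (Suc r) ` {..<P (Suc r)} = power_cosets G (E r ` {..<P r}) (x r) (ns ! r)"
proof
  have p: "0 < P r" by (rule place_value_pos[OF ns])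
  show "E (Suc r) ` {..<P (Suc r)} \<subseteq> power_cosets G (E r ` {..<P r}) (x r) (ns ! r)"
  proof
    fix z assume "z \<in> E (Suc r) ` {..<P (Suc r)}"
    then obtain i where i: "i < P (Suc r)" "z = E (Suc r) i" by auto
    then have "z = E (Suc r) (i div P r * P r + i mod P r)" by (metis div_mult_mod_eq)
    also have "\<dots> = E r (i mod P r) \<otimes> x r [^] (i div P r)"
      using less_place_value_SucD[OF i(1) r] p by (intro radix_elem_Suc_block r) auto
    finally show "z \<in> power_cosets G (E r ` {..<P r}) (x r) (ns ! r)"
      using less_place_value_SucD[OF i(1) r] p unfolding power_cosets_def by fastforce
  qed
  show "power_cosets G (E r ` {..<P r}) (x r) (ns ! r) \<subseteq> E (Suc r) ` {..<P (Suc r)}"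
  proof
    fix z assume "z \<in> power_cosets G (E r ` {..<P r}) (x r) (ns ! r)"
    then obtain k c where k: "k < P r" "c < ns ! r" "z = E r k \<otimes> x r [^] c"
      by (auto simp: power_cosets_def)
    then have "z = E (Suc r) (c * P r + k)" using radix_elem_Suc_block[OF r] by metis
    moreover have "c * P r + k < P (Suc r)"
      using block_less[OF k(2,1)] r by (simp add: prod_list_take_Suc mult.commute)
    ultimately show "z \<in> E (Suc r) ` {..<P (Suc r)}" by blast
  qed
qed

lemma radix_elem_eq_finprod:
  "r \<le> length ns \<Longrightarrow> E r i = (\<Otimes>s\<in>{..<r}. x s [^] digit ns i s)"
proof (induction r)
  case (Suc r)
  then have "(\<Otimes>s\<in>insert r {..<r}. x s [^] digit ns i s)
      = x r [^] digit ns i r \<otimes> (\<Otimes>s\<in>{..<r}. x s [^] digit ns i s)"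
    by (intro finprod_insert) (auto simp: x_closed)
  with Suc show ?case
    by (simp add: lessThan_Suc x_closed m_comm)
qed simp

end

text \<open>The added relation allows a carry out of digit \<open>s\<close> to be absorbed by the
  lower digits.\<close>

locale radix_system = radix_frame +
  assumes x_pow: "\<And>s. s < length ns \<Longrightarrow> x s [^] (ns ! s) \<in> E s ` {..<P s}"
begin

text \<open>Only the pair of top blocks sees the remainders of \<open>i\<close> and
  \<open>j\<close>, and there the claim one level down applies; hence the induction is over
  arbitrary \<open>i\<close> and \<open>j\<close>.\<close>

theorem radix_segment_mult:
  assumes "r \<le> length ns" "i < P r" "j < P r"
  shows "E r ` {..i} <#> E r ` {..j} = E r ` {..radix_type ns r i j}"
  using assms
proof (induction r arbitrary: i j)
  case 0
  then show ?case by (simp add: set_mult_def)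
next
  case (Suc r)
  define p n where "p = P r" and "n = ns ! r"
  define y where "y = x r"
  have r: "r < length ns" using Suc by simp
  have p: "0 < p" unfolding p_def by (rule place_value_pos[OF ns])
  have n: "1 < n" using ns r nth_mem[of r ns] unfolding n_def by blast
  have y: "y \<in> carrier G" using x_closed r by (simp add: y_def)
  have cl: "E r k \<in> carrier G" "E (Suc r) k \<in> carrier G" for k
    using r by (auto intro!: radix_elem_closed simp del: radix_elem.simps)
  have IH: "E r ` {..i'} <#> E r ` {..j'} = E r ` {..radix_type ns r i' j'}"
    if "i' < p" "j' < p" for i' j'
    using Suc.IH that r by (simp add: p_def)
  have prodI: "E r k \<otimes> E r l \<in> E r ` {..radix_type ns r i' j'}"
    if "i' < p" "j' < p" "k \<le> i'" "l \<le> j'" for i' j' k l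
    unfolding IH[OF that(1,2), symmetric] using that by (auto simp: set_mult_def)
  have B: "{..p - 1} = {..<p}" using p by auto
  \<comment> \<open>The induction hypothesis at the last index says that the whole lower level is
    closed under multiplication.\<close>
  have closedB: "E r k \<otimes> E r l \<in> E r ` {..<p}" if "k < p" "l < p" for k l
    using prodI[of "p - 1" "p - 1" k l] that radix_type_last[OF ns, of r] r p
    unfolding p_def[symmetric] B[symmetric] by simp
  have ypow: "y [^] n \<in> E r ` {..<p}" using x_pow[OF r] by (simp add: y_def n_def p_def)
  have blk: "E (Suc r) (c * p + k) = E r k \<otimes> y [^] c" if "c < n" "k < p" for c k
    using radix_elem_Suc_block[OF r] that unfolding p_def n_def y_def by blast
  have swap: "(E r k \<otimes> y [^] c) \<otimes> (E r l \<otimes> y [^] d) = (E r k \<otimes> E r l) \<otimes> y [^] (c + d)" for k l and c d :: nat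
    using cl y by (simp add: nat_pow_mult[symmetric] m_ac)
  define a i0 b j0 where "a = i div p" and "i0 = i mod p" and "b = j div p" and "j0 = j mod p"
  have i: "i = a * p + i0" and j: "j = b * p + j0" and lt: "i0 < p" "j0 < p"
    unfolding a_def i0_def b_def j0_def using p by auto
  have ab: "a < n" "b < n"
    using Suc.prems r less_place_value_SucD unfolding a_def b_def p_def n_def by auto
  define T where "T = radix_type ns (Suc r) i j"
  have T1: "T = n * p - 1" if "n \<le> a + b"
    using that by (simp add: T_def a_def b_def p_def n_def Let_def)
  have T2: "T = (a + b) * p + radix_type ns r i0 j0" if "a + b < n"
    using that by (simp add: T_def a_def b_def i0_def j0_def p_def n_def Let_def)
  have Tr: "radix_type ns r i0 j0 < p"
    unfolding p_def using radix_type_less[OF ns] r by simp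
  \<comment> \<open>Every block strictly below \<open>a + b\<close> lies entirely in the product,
    whatever the remainders \<open>i0\<close> and \<open>j0\<close> are.\<close>
  have full: "E (Suc r) (c * p + k) \<in> E (Suc r) ` {..i} <#> E (Suc r) ` {..j}"
    if c: "c < n" "c < a + b" and k: "k < p" for c k
  proof -
    have "\<exists>i' j'. i' \<le> i \<and> j' \<le> j \<and>
        E (Suc r) (c * p + k) = E (Suc r) i' \<otimes> E (Suc r) j'"
    proof (cases "a = 0")
      case True
      have "c * p + k \<le> b * p" using block_less[of c b k p] c k True by simp
      moreover have "E (Suc r) 0 \<otimes> E (Suc r) (c * p + k) = E (Suc r) (c * p + k)"
        using r cl radix_elem_0 by (simp del: radix_elem.simps)
      ultimately show ?thesis using j
        by (metis le0 le_add1 le_trans)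
    next
      case False
      \<comment> \<open>The exponent \<open>c\<close> is split as \<open>a' + b'\<close> with
        \<open>a' < a\<close> strictly, so that all of block \<open>a'\<close> is available on the
        left; on the right only the first element of block \<open>b'\<close> is used.\<close>
      define a' b' where "a' = min c (a - 1)" and "b' = c - a'"
      have ab': "a' < a" "b' \<le> b" "a' + b' = c" "b' < n"
        using False c ab unfolding a'_def b'_def by auto
      have "a' * p + k \<le> a * p" using block_less[of a' a k p] ab' k by simp
      moreover have "E (Suc r) (b' * p + 0) = E r 0 \<otimes> y [^] b'"
        by (rule blk) (use ab' p in auto)
      moreover have "E r 0 = \<one>" using r radix_elem_0 by simp
      moreover have "b' * p \<le> b * p + j0" using ab'(2) by (intro trans_le_add1 mult_le_mono1)
      ultimately have "E (Suc r) (c * p + k) = E (Suc r) (a' * p + k) \<otimes> E (Suc r) (b' * p)"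
          "a' * p + k \<le> i" "b' * p \<le> j"
        using i j ab' ab k blk[of a' k] blk[of c k] c cl y
        by (simp_all add: m_assoc nat_pow_mult del: radix_elem.simps)
      then show ?thesis by blast
    qed
    then show ?thesis unfolding set_mult_def by blast
  qed
  have sub1: "E (Suc r) k \<otimes> E (Suc r) l \<in> E (Suc r) ` {..T}" if k: "k \<le> i" and l: "l \<le> j" for k l
  proof -
    define c k0 d l0 where "c = k div p" and "k0 = k mod p" and "d = l div p" and "l0 = l mod p"
    have kl: "k = c * p + k0" "l = d * p + l0" and lt0: "k0 < p" "l0 < p"
      unfolding c_def k0_def d_def l0_def using p by auto
    have cd: "c \<le> a" "d \<le> b" using k l div_le_mono unfolding c_def d_def a_def b_def by auto
    have prod: "E (Suc r) k \<otimes> E (Suc r) l = (E r k0 \<otimes> E r l0) \<otimes> y [^] (c + d)"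
      using blk[of c k0] blk[of d l0] cd ab lt0 swap by (simp add: kl del: radix_elem.simps)
    obtain m where m: "m < p" "E r k0 \<otimes> E r l0 = E r m" using closedB[OF lt0] by auto
    show ?thesis
    proof (cases "n \<le> a + b")
      case True
      have "E (Suc r) k \<otimes> E (Suc r) l \<in> E (Suc r) ` {..<n * p}"
      proof (cases "c + d < n")
        case True
        then have "E (Suc r) k \<otimes> E (Suc r) l = E (Suc r) ((c + d) * p + m)"
          using prod m blk[of "c + d" m] by (simp del: radix_elem.simps)
        then show ?thesis using block_less[OF True m(1)] by blast
      next
        case False
        \<comment> \<open>The overflow is removed by trading \<open>y [^] n\<close> for an element
          of the lower level.\<close>
        obtain u where u: "u < p" "y [^] n = E r u" using ypow by auto
        obtain v where v: "v < p" "E r m \<otimes> E r u = E r v" using closedB[OF m(1) u(1)] by auto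
        have less: "c + d - n < n" using cd ab by auto
        have "y [^] (c + d) = E r u \<otimes> y [^] (c + d - n)"
          using False y by (simp add: u(2)[symmetric] nat_pow_mult)
        then have "E (Suc r) k \<otimes> E (Suc r) l = E r v \<otimes> y [^] (c + d - n)"
          using prod m(2) v(2) cl y by (simp add: m_assoc[symmetric])
        also have "\<dots> = E (Suc r) ((c + d - n) * p + v)" using blk less v by simp
        finally show ?thesis using block_less[OF less v(1)] by blast
      qed
      moreover have "{..<n * p} \<subseteq> {..T}" using T1[OF True] by auto
      ultimately show ?thesis by blast
    next
      case False
      then have lessn: "c + d < n" using cd by auto
      show ?thesis
      \<comment> \<open>Only for the two top blocks do the remainders restrict the result; otherwise
        \<open>c + d < a + b\<close> and any remainder \<open>m\<close> fits below
        \<open>T\<close>.\<close>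
      proof (cases "c = a \<and> d = b")
        case True
        then have "k0 \<le> i0" "l0 \<le> j0" using k l kl i j by auto
        then obtain w where w: "w \<le> radix_type ns r i0 j0" "E r k0 \<otimes> E r l0 = E r w"
          using prodI[OF lt] by blast
        then have "E (Suc r) k \<otimes> E (Suc r) l = E (Suc r) ((c + d) * p + w)"
          using prod blk[of "c + d" w] lessn Tr by (simp del: radix_elem.simps)
        moreover have "(c + d) * p + w \<le> T" using T2 w True False by simp
        ultimately show ?thesis by blast
      next
        case False2: False
        then have "c + d < a + b" using cd by auto
        then have "(c + d) * p + m \<le> T" using T2 False block_less[of "c + d" "a + b" m p] m by simp
        moreover have "E (Suc r) k \<otimes> E (Suc r) l = E (Suc r) ((c + d) * p + m)"
          using prod m blk[of "c + d" m] lessn by (simp del: radix_elem.simps)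
        ultimately show ?thesis by blast
      qed
    qed
  qed
  \<comment> \<open>An index up to \<open>T\<close> lies in a block below \<open>a + b\<close>,
    where \<open>full\<close> applies, or there is no carry and it lies in block
    \<open>a + b\<close> itself.\<close>
  have sub2: "E (Suc r) k \<in> E (Suc r) ` {..i} <#> E (Suc r) ` {..j}" if k: "k \<le> T" for k
  proof -
    define c k0 where "c = k div p" and "k0 = k mod p"
    have kc: "k = c * p + k0" and k0: "k0 < p" unfolding c_def k0_def using p by auto
    have "k < P (Suc r)"
      using k radix_type_less[OF ns, where r="Suc r" and i=i and j=j] r by (simp add: T_def del: radix_type.simps)
    then have cn: "c < n" using less_place_value_SucD r unfolding c_def p_def n_def by blast
    show ?thesis
    proof (cases "c < a + b")
      case True
      then show ?thesis using full cn k0 kc by blast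
    next
      case False
      with cn have lessn: "a + b < n" by simp
      have "c = a + b" "k0 \<le> radix_type ns r i0 j0"
      proof -
        show c: "c = a + b"
        proof (rule ccontr)
          assume "c \<noteq> a + b"
          then have "a + b < c" using False by simp
          then have "(a + b) * p + radix_type ns r i0 j0 < c * p" using block_less Tr by blast
          then show False using k kc T2[OF lessn] by simp
        qed
        show "k0 \<le> radix_type ns r i0 j0" using k kc T2[OF lessn] c by simp
      qed
      then have "E r k0 \<in> E r ` {..i0} <#> E r ` {..j0}" using IH[OF lt] by blast
      then obtain u v where uv: "u \<le> i0" "v \<le> j0" "E r k0 = E r u \<otimes> E r v"
        by (auto simp: set_mult_def)
      have "E (Suc r) k = E (Suc r) (a * p + u) \<otimes> E (Suc r) (b * p + v)"
        using blk[of c k0] blk[of a u] blk[of b v] swap uv lt ab cn k0 \<open>c = a + b\<close>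
        by (simp add: kc del: radix_elem.simps)
      moreover have "a * p + u \<le> i" "b * p + v \<le> j" using uv i j by auto
      ultimately show ?thesis unfolding set_mult_def by blast
    qed
  qed
  show ?case
    using sub1 sub2 unfolding T_def[symmetric] by (auto simp: set_mult_def simp del: radix_elem.simps)
qed

text \<open>By injectivity the segments have distinct sizes, so one segment is contained in another
  only if its index is at most as large; the product segment itself therefore gives the
  minimum.\<close>

lemma flag_type_radix_elem:
  assumes ord: "order G = prod_list ns"
    and inj: "inj_on (E (length ns)) {..<prod_list ns}"
    and ij: "i < order G" "j < order G"
  shows "flag_type G (\<lambda>i. E (length ns) ` {..i}) i j = radix_type ns (length ns) i j"
proof -
  let ?T = "radix_type ns (length ns) i j"
  have lt: "?T < order G" using radix_type_less[OF ns, of "length ns"] ord by simp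
  have card: "card (E (length ns) ` {..k}) = k + 1" if "k < order G" for k
    using that ord by (subst card_image) (auto intro: inj_on_subset[OF inj])
  have eq: "E (length ns) ` {..i} <#> E (length ns) ` {..j} = E (length ns) ` {..?T}"
    by (rule radix_segment_mult) (use ij ord in auto)
  show ?thesis
    unfolding flag_type_def eq
  proof (rule Least_equality)
    show "?T < order G \<and> E (length ns) ` {..?T} \<subseteq> E (length ns) ` {..?T}" using lt by simp
  next
    fix k assume k: "k < order G \<and> E (length ns) ` {..?T} \<subseteq> E (length ns) ` {..k}"
    then have "card (E (length ns) ` {..?T}) \<le> card (E (length ns) ` {..k})"
      by (intro card_mono) auto
    then show "?T \<le> k" using card lt k by simp
  qed
qed

lemma flag_radix_elem:
  assumes ord: "order G = prod_list ns"
    and inj: "inj_on (E (length ns)) {..<prod_list ns}"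
  shows "flag G (\<lambda>i. E (length ns) ` {..i})"
proof -
  let ?g = "E (length ns)"
  have pos: "0 < order G" using place_value_pos[OF ns, of "length ns"] ord by simp
  have inj': "inj_on ?g {..k}" if "k < order G" for k
    using that ord by (auto intro: inj_on_subset[OF inj])
  have "card (?g ` {..order G - 1}) = order G"
    using inj' pos by (subst card_image) auto
  then have "?g ` {..order G - 1} = carrier G"
    using pos radix_elem_closed[of "length ns"]
    by (intro card_subset_eq) (auto simp: order_def card_gt_0_iff)
  moreover have "?g ` {..i} \<subset> ?g ` {..Suc i}" if "Suc i < order G" for i
    using inj'[OF that] by (auto simp: inj_on_def atMost_Suc)
  moreover have "card (?g ` {..i}) = i + 1" if "i < order G" for i
    using inj'[OF that] by (simp add: card_image)
  ultimately show ?thesis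
    unfolding flag_def using radix_elem_0 by simp
qed

end

subsection \<open>Products of cyclic groups\<close>

lemma comm_group_tower_group: "comm_group (tower_group ns)"
  unfolding tower_group_def
  by (rule group.group_comm_groupI) (auto simp: add.commute)

lemma order_tower_group:
  assumes "\<forall>m\<in>set ns. 1 < m"
  shows "order (tower_group ns) = prod_list ns"
proof -
  have "card (carrier (integer_mod_group (ns ! s))) = ns ! s" if "s < length ns" for s
    using assms nth_mem[OF that] by (force simp: carrier_integer_mod_group)
  then show ?thesis
    by (simp add: order_def tower_group_def card_PiE prod.list_conv_set_nth atLeast0LessThan)
qed

lemma pow_tower_group:
  fixes m :: nat
  assumes "m > 0 \<or> True"
  shows "factor_emb ns s a [^]\<^bsub>tower_group ns\<^esub> m =
    (\<lambda>q\<in>{..<length ns}. if q = s then int m * a mod int (ns ! s) else 0)"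
proof (induction m)
  case (Suc m)
  have "(int m * a + a) mod int (ns ! s) = int (Suc m) * a mod int (ns ! s)"
    by (simp add: algebra_simps)
  then have step: "(int m * a mod int (ns ! s) + a) mod int (ns ! s) = int (Suc m) * a mod int (ns ! s)"
    by (simp only: mod_add_left_eq)
  have mult: "f \<otimes>\<^bsub>tower_group ns\<^esub> g = (\<lambda>q\<in>{..<length ns}. (f q + g q) mod int (ns ! q))" for f g
    by (simp add: tower_group_def)
  show ?case
    unfolding nat_pow_Suc Suc.IH mult unfolding factor_emb_def
    by (rule restrict_ext) (simp add: step del: of_nat_Suc)
qed (auto simp: tower_group_def)

text \<open>A generator has order \<open>n\<close>, and powers with exponents below the order are
  distinct.\<close>

lemma integer_mod_group_generator_inj:
  assumes "0 < n" and a: "a \<in> carrier (integer_mod_group n)"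
    and gen: "subgroup_generated (integer_mod_group n) {a} = integer_mod_group n"
    and eq: "int k * a mod int n = int l * a mod int n" and "k < n" "l < n"
  shows "k = l"
proof -
  interpret group "integer_mod_group n" by simp
  have "ord a = card (carrier (subgroup_generated (integer_mod_group n) {a}))"
    using generate_pow_card[OF a] a by (simp add: carrier_subgroup_generated)
  then have "ord a = n"
    using assms(1) by (simp add: gen carrier_integer_mod_group)
  then have "k \<in> {0..ord a - 1}" "l \<in> {0..ord a - 1}"
    using assms(5,6) by auto
  moreover have "a [^]\<^bsub>integer_mod_group n\<^esub> k = a [^]\<^bsub>integer_mod_group n\<^esub> l"
    using eq by (simp only: pow_integer_mod_group)
  ultimately show ?thesis
    using inj_onD[OF ord_inj[OF a]] by blast
qed

lemma radix_system_tower_group: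
  assumes ns: "\<forall>m\<in>set ns. 1 < m" and e: "tower_gens ns e"
  shows "radix_system (tower_group ns) ns (\<lambda>s. factor_emb ns s (e s))"
proof -
  interpret comm_group "tower_group ns" by (rule comm_group_tower_group)
  show ?thesis
  proof
    show "\<forall>m\<in>set ns. 1 < m" by (rule ns)
    show "factor_emb ns s (e s) \<in> carrier (tower_group ns)" if "s < length ns" for s
      using that e by (auto simp: tower_group_def factor_emb_def tower_gens_def)
    show "factor_emb ns s (e s) [^]\<^bsub>tower_group ns\<^esub> (ns ! s)
        \<in> radix_elem (tower_group ns) ns (\<lambda>s. factor_emb ns s (e s)) s ` {..<place_value ns s}"
      if "s < length ns" for s
    proof -
      have "radix_elem (tower_group ns) ns (\<lambda>s. factor_emb ns s (e s)) r 0 = \<one>\<^bsub>tower_group ns\<^esub>" for r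
        by (induction r) (auto simp: digit_def)
      moreover have "factor_emb ns s (e s) [^]\<^bsub>tower_group ns\<^esub> (ns ! s) = \<one>\<^bsub>tower_group ns\<^esub>"
        using pow_tower_group[where ns=ns and s=s and a="e s" and m="ns ! s"]
        by (auto simp: tower_group_def intro!: restrict_ext)
      moreover have "0 \<in> {..<place_value ns s}" using place_value_pos[OF ns, of s] by simp
      ultimately show ?thesis by (metis imageI)
    qed
  qed
qed

lemma radix_elem_tower_group:
  assumes "r \<le> length ns" "q < length ns"
  shows "radix_elem (tower_group ns) ns (\<lambda>s. factor_emb ns s (e s)) r i q =
    (if q < r then int (digit ns i q) * e q mod int (ns ! q) else 0)"
  using assms
proof (induction r)
  case (Suc r)
  have "radix_elem (tower_group ns) ns (\<lambda>s. factor_emb ns s (e s)) (Suc r) i q =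
    (radix_elem (tower_group ns) ns (\<lambda>s. factor_emb ns s (e s)) r i q +
      (factor_emb ns r (e r) [^]\<^bsub>tower_group ns\<^esub> digit ns i r) q) mod int (ns ! q)"
    using Suc.prems by (simp add: tower_group_def)
  then show ?case
    using Suc by (auto simp: pow_tower_group)
qed (simp add: tower_group_def)

text \<open>Coordinate \<open>s\<close> determines digit \<open>s\<close> because \<open>e s\<close>
  generates its factor, and the digits determine the index.\<close>

lemma inj_on_radix_elem_tower_group:
  assumes ns: "tower_type n ns" and e: "tower_gens ns e"
  shows "inj_on (radix_elem (tower_group ns) ns (\<lambda>s. factor_emb ns s (e s)) (length ns)) {..<n}"
proof (rule inj_onI)
  fix i j assume ij: "i \<in> {..<n}" "j \<in> {..<n}"
    and eq: "radix_elem (tower_group ns) ns (\<lambda>s. factor_emb ns s (e s)) (length ns) i =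
      radix_elem (tower_group ns) ns (\<lambda>s. factor_emb ns s (e s)) (length ns) j"
  have "digit ns i s = digit ns j s" if s: "s < length ns" for s
  proof (rule integer_mod_group_generator_inj)
    show "int (digit ns i s) * e s mod int (ns ! s) = int (digit ns j s) * e s mod int (ns ! s)"
      using fun_cong[OF eq, of s] s by (simp add: radix_elem_tower_group)
    show "digit ns i s < ns ! s" "digit ns j s < ns ! s"
      using digit_less[OF ns s] by auto
    then show "0 < ns ! s" by simp
  qed (use e s in \<open>auto simp: tower_gens_def\<close>)
  then show "i = j"
    using digit_sum[OF ns, of i] digit_sum[OF ns, of j] ij by simp
qed

text \<open>The right side does not involve \<open>e\<close>: the flag type is the same for every
  choice of generators.\<close>

lemma tower_flag_type_eq_radix_type:
  assumes tt: "tower_type n ns" and e: "tower_gens ns e" and ij: "i < n" "j < n"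
  shows "tower_flag_type ns e i j = radix_type ns (length ns) i j"
proof -
  have gt1: "\<forall>m\<in>set ns. 1 < m" and n: "n = prod_list ns"
    using tt by (auto simp: tower_type_def)
  interpret radix_system "tower_group ns" ns "\<lambda>s. factor_emb ns s (e s)"
    by (rule radix_system_tower_group[OF gt1 e])
  have "tower_elem ns e i = E (length ns) i" for i
    by (simp add: tower_elem_def radix_elem_eq_finprod)
  then have "tower_flag ns e = (\<lambda>i. E (length ns) ` {..i})"
    unfolding tower_flag_def by presburger
  then show ?thesis
    using flag_type_radix_elem order_tower_group[OF gt1] inj_on_radix_elem_tower_group[OF tt e] ij n
    by (simp add: tower_flag_type_def)
qed

subsection \<open>Cyclic quotients and filtrations\<close>

context comm_group
begin

lemma
  assumes A: "subgroup A G" and B: "subgroup B G" and AB: "A \<subseteq> B"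
  shows normal_in_subgroup: "A \<lhd> G\<lparr>carrier := B\<rparr>"
    and FactGroup_subgroup_pow: "y \<in> B \<Longrightarrow>
      (A #> y) [^]\<^bsub>G\<lparr>carrier := B\<rparr> Mod A\<^esub> (k::nat) = A #> y [^] k"
    and carrier_FactGroup_subgroup: "carrier (G\<lparr>carrier := B\<rparr> Mod A) = (\<lambda>b. A #> b) ` B"
proof -
  have H: "comm_group (G\<lparr>carrier := B\<rparr>)"
    using B by (intro group.group_comm_groupI subgroup_imp_group) (auto intro: m_comm subgroup.mem_carrier)
  have sub: "subgroup A (G\<lparr>carrier := B\<rparr>)"
    by (rule subgroup_incl[OF A B AB])
  show *: "A \<lhd> G\<lparr>carrier := B\<rparr>"
    by (rule comm_group.subgroup_imp_normal[OF H sub])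
  show "(A #> y) [^]\<^bsub>G\<lparr>carrier := B\<rparr> Mod A\<^esub> k = A #> y [^] k" if "y \<in> B"
    using normal.FactGroup_pow[OF *, of y k] that
    by (simp add: r_coset_def flip: nat_pow_consistent)
  show "carrier (G\<lparr>carrier := B\<rparr> Mod A) = (\<lambda>b. A #> b) ` B"
    by (simp add: carrier_FactGroup r_coset_def)
qed

lemma order_FactGroup_subgroup:
  assumes A: "subgroup A G" and B: "subgroup B G" and AB: "A \<subseteq> B"
  shows "order (G\<lparr>carrier := B\<rparr> Mod A) * card A = card B"
proof -
  have H: "comm_group (G\<lparr>carrier := B\<rparr>)"
    using B by (intro group.group_comm_groupI subgroup_imp_group) (auto intro: m_comm subgroup.mem_carrier)
  show ?thesis
    using group.lagrange[OF comm_group.axioms(2)[OF H] subgroup_incl[OF A B AB]] by (simp add: order_def FactGroup_def)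
qed

text \<open>The coset of \<open>a \<otimes> y [^] c\<close> equals that of \<open>y [^] c\<close>,
  so every element of the quotient is a power of \<open>A #> y\<close>.\<close>

lemma cyclic_FactGroupI:
  assumes A: "subgroup A G" and B: "subgroup B G" and AB: "A \<subseteq> B"
    and y: "y \<in> B" and gen: "B \<subseteq> power_cosets G A y n"
  shows "cyclic_group (G\<lparr>carrier := B\<rparr> Mod A)"
proof -
  let ?Q = "G\<lparr>carrier := B\<rparr> Mod A"
  have Q: "group ?Q"
    using normal_in_subgroup[OF A B AB] by (rule normal.factorgroup_is_group)
  have y': "y \<in> carrier G" by (rule subgroup.mem_carrier[OF B y])
  have X: "A #> y \<in> carrier ?Q"
    using y by (simp add: carrier_FactGroup_subgroup[OF A B AB])
  have "carrier ?Q \<subseteq> range (\<lambda>n::int. (A #> y) [^]\<^bsub>?Q\<^esub> n)"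
  proof
    fix Z assume "Z \<in> carrier ?Q"
    then obtain b where "b \<in> B" "Z = A #> b"
      by (auto simp: carrier_FactGroup_subgroup[OF A B AB])
    then obtain a c where ac: "a \<in> A" "Z = A #> (a \<otimes> y [^] (c::nat))"
      using gen by (auto simp: power_cosets_def)
    then have "Z = A #> y [^] c"
      using coset_mult_assoc[OF subgroup.subset[OF A] subgroup.mem_carrier[OF A ac(1)], of "y [^] c"]
        coset_join2[OF subgroup.mem_carrier[OF A ac(1)] A ac(1)] y' by simp
    then have "Z = (A #> y) [^]\<^bsub>?Q\<^esub> int c"
      using FactGroup_subgroup_pow[OF A B AB y, of c] by (simp only: int_pow_int)
    then show "Z \<in> range (\<lambda>n::int. (A #> y) [^]\<^bsub>?Q\<^esub> n)" by blast
  qed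
  moreover have "range (\<lambda>n::int. (A #> y) [^]\<^bsub>?Q\<^esub> n) \<subseteq> carrier ?Q"
    using group.int_pow_closed[OF Q X] by blast
  ultimately show ?thesis
    unfolding group.cyclic_group[OF Q] by (intro bexI[OF _ X] subset_antisym)
qed

text \<open>The element \<open>y\<close> is a representative of a generating coset. The order
  \<open>n\<close> of the quotient puts \<open>y [^] n\<close> into \<open>A\<close> and bounds the
  exponents that are required.\<close>

lemma cyclic_FactGroupE:
  assumes A: "subgroup A G" and B: "subgroup B G" and AB: "A \<subseteq> B"
    and cyc: "cyclic_group (G\<lparr>carrier := B\<rparr> Mod A)"
    and n: "order (G\<lparr>carrier := B\<rparr> Mod A) = n" "0 < n"
  obtains y where "y \<in> B" "y [^] n \<in> A" "B = power_cosets G A y n"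
proof -
  let ?Q = "G\<lparr>carrier := B\<rparr> Mod A"
  have Q: "group ?Q"
    using normal_in_subgroup[OF A B AB] by (rule normal.factorgroup_is_group)
  have fin: "finite (carrier ?Q)" using n by (metis order_gt_0_iff_finite order_def card_gt_0_iff)
  obtain Y where Y: "Y \<in> carrier ?Q" "subgroup_generated ?Q {Y} = ?Q"
    using cyc by (auto simp: cyclic_group_def)
  obtain y where y: "y \<in> B" "Y = A #> y"
    using Y(1) by (auto simp: carrier_FactGroup_subgroup[OF A B AB])
  have BG: "B \<subseteq> carrier G" by (rule subgroup.subset[OF B])
  have pow: "Y [^]\<^bsub>?Q\<^esub> k = A #> y [^] k" for k :: nat
    using FactGroup_subgroup_pow[OF A B AB y(1)] y(2) by simp
  have yB: "y [^] k \<in> B" for k :: nat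
    by (induction k) (simp_all add: y(1) subgroup.m_closed[OF B] subgroup.one_closed[OF B])
  have Yn: "Y [^]\<^bsub>?Q\<^esub> n = \<one>\<^bsub>?Q\<^esub>"
    using group.pow_order_eq_1[OF Q Y(1)] n by simp
  then have "A #> y [^] n = A" by (simp add: pow)
  then have yn: "y [^] n \<in> A"
    using rcos_self[OF _ A, of "y [^] n"] yB BG by blast
  have "B \<subseteq> power_cosets G A y n"
  proof
    fix b assume b: "b \<in> B"
    have "carrier ?Q = generate ?Q {Y}"
      using Y by (metis Int_insert_right_if1 Int_empty_right carrier_subgroup_generated)
    then have "carrier ?Q = {Y [^]\<^bsub>?Q\<^esub> k | k. k \<in> (UNIV :: nat set)}"
      using group.generate_pow_on_finite_carrier[OF Q fin Y(1)] by simp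
    moreover have "A #> b \<in> carrier ?Q" using b by (simp add: carrier_FactGroup_subgroup[OF A B AB])
    ultimately obtain k :: nat where k: "A #> b = Y [^]\<^bsub>?Q\<^esub> k" by auto
    \<comment> \<open>The exponent is reduced modulo \<open>n\<close>, using that the
      \<open>n\<close>-th power of \<open>Y\<close> is trivial.\<close>
    have "Y [^]\<^bsub>?Q\<^esub> k = Y [^]\<^bsub>?Q\<^esub> (n * (k div n) + k mod n)" by simp
    also have "\<dots> = Y [^]\<^bsub>?Q\<^esub> (k mod n)"
      unfolding monoid.nat_pow_mult[OF group.is_monoid[OF Q] Y(1), symmetric]
        monoid.nat_pow_pow[OF group.is_monoid[OF Q] Y(1), symmetric] Yn
      using Y(1) group.is_monoid[OF Q] by (simp add: monoid.nat_pow_one monoid.l_one monoid.nat_pow_closed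
        del: one_FactGroup mult_FactGroup)
    finally have "b \<in> A #> y [^] (k mod n)"
      using k pow rcos_self[OF _ A, of b] b BG by auto
    then show "b \<in> power_cosets G A y n"
      using n(2) mod_less_divisor by (fastforce simp: r_coset_def power_cosets_def)
  qed
  moreover have "power_cosets G A y n \<subseteq> B"
    using yB AB by (auto simp: power_cosets_def intro!: subgroup.m_closed[OF B])
  ultimately show ?thesis using that[OF y(1) yn] by blast
qed

text \<open>Each \<open>x s\<close> represents a generator of the quotient of
  \<open>S (Suc s)\<close> by \<open>S s\<close>; by induction the level \<open>s\<close> of the
  enumeration is then exactly \<open>S s\<close>.\<close>

lemma cyclic_filtration_radix_systemE:
  assumes ns: "\<forall>m\<in>set ns. 1 < m" and S: "cyclic_filtration G ns S"
  obtains x where "radix_system G ns x"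
    "radix_elem G ns x (length ns) ` {..<prod_list ns} = carrier G"
proof -
  have sub: "subgroup (S i) G" if "i \<le> length ns" for i
    using S that by (simp add: cyclic_filtration_def)
  have "\<exists>y. y \<in> S (Suc s) \<and> y [^] (ns ! s) \<in> S s \<and> S (Suc s) = power_cosets G (S s) y (ns ! s)"
    if s: "s < length ns" for s
  proof -
    have "0 < ns ! s" using ns nth_mem[OF s] by fastforce
    moreover have "S s \<subseteq> S (Suc s)" "cyclic_group (G\<lparr>carrier := S (Suc s)\<rparr> Mod S s)"
      "order (G\<lparr>carrier := S (Suc s)\<rparr> Mod S s) = ns ! s"
      using S s by (auto simp: cyclic_filtration_def)
    ultimately show ?thesis
      using cyclic_FactGroupE[OF sub[of s] sub[of "Suc s"]] s by (metis Suc_leI less_imp_le)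
  qed
  then obtain x where x: "x s \<in> S (Suc s)" "x s [^] (ns ! s) \<in> S s"
      "S (Suc s) = power_cosets G (S s) (x s) (ns ! s)" if "s < length ns" for s
    by metis
  have "x s \<in> carrier G" if "s < length ns" for s
    using subgroup.mem_carrier[OF sub x(1)] that by simp
  then interpret radix_frame G ns x
    using ns by unfold_locales
  have image: "E s ` {..<P s} = S s" if "s \<le> length ns" for s
    using that
  proof (induction s)
    case 0
    then show ?case using S by (auto simp: cyclic_filtration_def)
  next
    case (Suc s)
    then show ?case using radix_elem_image_Suc[of s] x(3)[of s] by simp
  qed
  show ?thesis
  proof (rule that)
    show "radix_system G ns x"
      by unfold_locales (use x(2) image in auto)
    show "E (length ns) ` {..<prod_list ns} = carrier G"
      using image[of "length ns"] S by (simp add: cyclic_filtration_def)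
  qed
qed

text \<open>The enumeration maps \<open>order G\<close> indices onto the group, so it is injective
  and its initial segments form a flag.\<close>

lemma cyclic_filtration_imp_realizable:
  assumes tt: "tower_type (order G) ns" and S: "cyclic_filtration G ns S"
  shows "realizable G (radix_type ns (length ns))"
proof -
  have ns: "\<forall>m\<in>set ns. 1 < m" and ord: "order G = prod_list ns"
    using tt by (auto simp: tower_type_def)
  obtain x where x: "radix_system G ns x"
      "radix_elem G ns x (length ns) ` {..<prod_list ns} = carrier G"
    using cyclic_filtration_radix_systemE[OF ns S] .
  interpret radix_system G ns x by (rule x(1))
  have "inj_on (E (length ns)) {..<prod_list ns}"
    by (rule eq_card_imp_inj_on) (use x(2) ord in \<open>auto simp: order_def\<close>)
  then show ?thesis
    unfolding realizable_def
    using flag_radix_elem[OF ord] flag_type_radix_elem[OF ord] by blast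
qed

text \<open>In a finite group the inverse of \<open>a\<close> is the power
  \<open>a [^] (order G - 1)\<close>.\<close>

lemma subgroup_finite_closed:
  assumes fin: "finite (carrier G)" and A: "A \<subseteq> carrier G" "\<one> \<in> A"
    and closed: "\<And>a b. a \<in> A \<Longrightarrow> b \<in> A \<Longrightarrow> a \<otimes> b \<in> A"
  shows "subgroup A G"
proof (rule subgroupI)
  fix a assume a: "a \<in> A"
  then have ac: "a \<in> carrier G" using A by blast
  have pow: "a [^] k \<in> A" for k :: nat
    by (induction k) (simp_all add: A a closed)
  have "0 < order G" using fin by (simp add: order_gt_0_iff_finite)
  then have "a [^] (order G - 1) \<otimes> a = a [^] order G"
    by (metis Suc_diff_1 nat_pow_Suc)
  then have "inv a = a [^] (order G - 1)"
    using ac pow_order_eq_1 by (intro inv_equality) auto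
  then show "inv a \<in> A" using pow by simp
qed (use A closed in auto)

section \<open>Growth of unions of cosets of consecutive powers\<close>

lemma power_cosets_Suc:
  "power_cosets G A y (Suc k) = power_cosets G A y k \<union> (\<lambda>a. a \<otimes> y [^] k) ` A"
  by (auto simp: power_cosets_def less_Suc_eq)

text \<open>If the new coset met an earlier one, then solving for \<open>y [^] k\<close> would put
  it into the earlier union.\<close>

lemma card_power_cosets_Suc:
  assumes A: "subgroup A G" and fin: "finite (carrier G)" and y: "y \<in> carrier G"
    and notin: "y [^] k \<notin> power_cosets G A y k"
  shows "card (power_cosets G A y (Suc k)) = card (power_cosets G A y k) + card A"
proof -
  note Ac = subgroup.mem_carrier[OF A]
  have "power_cosets G A y k \<inter> (\<lambda>a. a \<otimes> y [^] k) ` A = {}"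
  proof (rule ccontr)
    assume "power_cosets G A y k \<inter> (\<lambda>a. a \<otimes> y [^] k) ` A \<noteq> {}"
    then obtain a b c where abc: "a \<in> A" "b \<in> A" "c < k" "a \<otimes> y [^] k = b \<otimes> y [^] c"
      by (auto simp: power_cosets_def)
    then have "y [^] k = (inv a \<otimes> b) \<otimes> y [^] c"
      using Ac y by (metis inv_closed inv_solve_left m_assoc m_closed nat_pow_closed)
    then show False
      using notin abc subgroup.m_closed[OF A subgroup.m_inv_closed[OF A abc(1)] abc(2)]
      by (auto simp: power_cosets_def)
  qed
  moreover have "card ((\<lambda>a. a \<otimes> y [^] k) ` A) = card A"
    using Ac y by (intro card_image inj_onI) simp
  moreover have "finite A" using Ac fin by (meson finite_subset subsetI)
  moreover have "power_cosets G A y k \<subseteq> carrier G"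
    using Ac y by (auto simp: power_cosets_def)
  ultimately show ?thesis
    unfolding power_cosets_Suc using fin by (simp add: card_Un_disjoint finite_subset)
qed

text \<open>Exponents at most \<open>k - 1\<close> and \<open>l - 1\<close> add up to at most
  \<open>k + l - 2\<close>.\<close>

lemma power_cosets_mult:
  assumes A: "subgroup A G" and y: "y \<in> carrier G"
    and "u \<in> power_cosets G A y k" "v \<in> power_cosets G A y l"
  shows "u \<otimes> v \<in> power_cosets G A y (k + l - 1)"
proof -
  obtain a b c d where ab: "a \<in> A" "b \<in> A" "c < k" "d < l" "u = a \<otimes> y [^] c" "v = b \<otimes> y [^] d"
    using assms by (auto simp: power_cosets_def)
  then have "u \<otimes> v = (a \<otimes> b) \<otimes> y [^] (c + d)"
    using y subgroup.mem_carrier[OF A] by (simp add: nat_pow_mult[symmetric] m_ac)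
  then show ?thesis
    using ab subgroup.m_closed[OF A ab(1,2)] unfolding power_cosets_def by fastforce
qed

lemma power_cosets_Suc_absorb:
  assumes A: "subgroup A G" and y: "y \<in> carrier G" and k: "y [^] k \<in> power_cosets G A y k"
  shows "power_cosets G A y (Suc k) = power_cosets G A y k"
proof -
  obtain b c where b: "b \<in> A" "c < k" "y [^] k = b \<otimes> y [^] c"
    using k by (auto simp: power_cosets_def)
  have "a \<otimes> y [^] k \<in> power_cosets G A y k" if "a \<in> A" for a
  proof -
    have "a \<otimes> y [^] k = (a \<otimes> b) \<otimes> y [^] c"
      using b y that subgroup.mem_carrier[OF A] by (simp add: m_assoc)
    then show ?thesis
      using b subgroup.m_closed[OF A that b(1)] unfolding power_cosets_def by blast
  qed
  then show ?thesis unfolding power_cosets_Suc by blast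
qed

end

subsection \<open>Flags of a tower type\<close>

locale radix_flag = comm_group G for G :: "('a, 'b) monoid_scheme" (structure) +
  fixes ns :: "nat list" and F :: "nat \<Rightarrow> 'a set"
  assumes fin: "finite (carrier G)"
    and tt: "tower_type (order G) ns"
    and flag: "flag G F"
    and type: "\<And>i j. i < order G \<Longrightarrow> j < order G \<Longrightarrow> flag_type G F i j = radix_type ns (length ns) i j"
begin

abbreviation "P \<equiv> place_value ns"

lemma ns: "\<forall>m\<in>set ns. 1 < m" and ord: "order G = prod_list ns"
  using tt by (auto simp: tower_type_def)

lemma P_pos: "0 < P r"
  by (rule place_value_pos[OF ns])

lemma P_le: "r \<le> length ns \<Longrightarrow> P r \<le> order G"
  using place_value_dvd[of r "length ns" ns] P_pos[of "length ns"] by (simp add: ord dvd_imp_le)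

lemma card_F: "i < order G \<Longrightarrow> card (F i) = i + 1"
  using flag by (simp add: flag_def)

lemma F_mono: "i \<le> j \<Longrightarrow> j < order G \<Longrightarrow> F i \<subseteq> F j"
proof (induction j rule: dec_induct)
  case (step j)
  then show ?case using flag unfolding flag_def by (meson Suc_lessD order.trans psubset_imp_subset)
qed simp

lemma F_subset: "i < order G \<Longrightarrow> F i \<subseteq> carrier G"
  using F_mono[of i "order G - 1"] flag by (simp add: flag_def)

lemma finite_F: "i < order G \<Longrightarrow> finite (F i)"
  using F_subset fin finite_subset by blast

lemma one_F: "i < order G \<Longrightarrow> \<one> \<in> F i"
  using F_mono[of 0 i] flag by (simp add: flag_def)

text \<open>The minimum in the flag type is attained, since the last member of the flag is the whole
  group.\<close>

lemma F_mult_subset: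
  assumes "i < order G" "j < order G"
  shows "F i <#> F j \<subseteq> F (radix_type ns (length ns) i j)"
proof -
  let ?R = "\<lambda>k. k < order G \<and> F i <#> F j \<subseteq> F k"
  have "F i <#> F j \<subseteq> carrier G"
    using F_subset assms by (intro set_mult_closed) auto
  then have "?R (order G - 1)" using flag assms by (simp add: flag_def)
  then have "?R (LEAST k. ?R k)" by (rule LeastI)
  then show ?thesis using type[OF assms] by (simp add: flag_type_def)
qed

lemma radix_type_le:
  assumes "i < order G" "j < order G" "k < order G" "F i <#> F j \<subseteq> F k"
  shows "radix_type ns (length ns) i j \<le> k"
  unfolding type[OF assms(1,2), symmetric] flag_type_def using assms by (intro Least_le) simp

text \<open>The subgroups of the future filtration; the shift by one gives \<open>layer s\<close>
  exactly \<open>P s\<close> elements.\<close>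

definition layer :: "nat \<Rightarrow> 'a set" where
  "layer s = F (P s - 1)"

lemma layer_index_less: "s \<le> length ns \<Longrightarrow> P s - 1 < order G"
  using P_pos[of s] P_le[of s] by simp

lemma card_layer: "s \<le> length ns \<Longrightarrow> card (layer s) = P s"
  using card_F[OF layer_index_less] P_pos[of s] by (simp add: layer_def)

lemma subgroup_layer:
  assumes s: "s \<le> length ns"
  shows "subgroup (layer s) G"
proof (rule subgroup_finite_closed[OF fin])
  show "layer s \<subseteq> carrier G" "\<one> \<in> layer s"
    unfolding layer_def using F_subset one_F layer_index_less[OF s] by auto
  have "radix_type ns (length ns) (P s - 1) (P s - 1) = P s - 1"
    using radix_type_level[OF ns s order_refl] radix_type_last[OF ns s] P_pos[of s] by simp
  then have "layer s <#> layer s \<subseteq> layer s"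
    using F_mult_subset[OF layer_index_less[OF s] layer_index_less[OF s]] by (simp add: layer_def)
  then show "a \<otimes> b \<in> layer s" if "a \<in> layer s" "b \<in> layer s" for a b
    using that by (auto simp: set_mult_def)
qed

text \<open>From index \<open>k * p - 1\<close> to \<open>Suc k * p - 1\<close> the flag gains
  \<open>p\<close> elements, which is exactly one new coset of \<open>layer s\<close>.\<close>

lemma layer_Suc_eq_power_cosets:
  assumes s: "s < length ns"
  obtains y where "y \<in> layer (Suc s)" "layer (Suc s) = power_cosets G (layer s) y (ns ! s)"
proof -
  define p n A where "p = P s" and "n = ns ! s" and "A = layer s"
  have p: "0 < p" unfolding p_def by (rule P_pos)
  have n: "1 < n" using ns nth_mem[OF s] unfolding n_def by blast
  have np: "n * p = P (Suc s)" using s by (simp add: prod_list_take_Suc p_def n_def mult.commute)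
  have A: "subgroup A G" and card_A: "card A = p" and AF: "A = F (p - 1)"
    using subgroup_layer card_layer s by (auto simp: A_def p_def layer_def)
  have le: "k * p \<le> order G" if "k \<le> n" for k
    using mult_le_mono1[OF that, of p] P_le[of "Suc s"] s np by simp
  have lt: "k * p - 1 < order G" if "0 < k" "k \<le> n" for k
    using le[OF that(2)] p that(1) by (cases "k * p") auto
  have p_less: "p \<le> 2 * p - 1" "2 * p - 1 < order G"
    using p n lt[of 2] by auto
  have "A \<subset> F p"
  proof -
    have "Suc (p - 1) < order G" using p_less p by simp
    then have "F (p - 1) \<subset> F (Suc (p - 1))" using flag unfolding flag_def by blast
    then show ?thesis using p AF by simp
  qed
  \<comment> \<open>This is the single element that the flag gains right after the subgroup
    \<open>A\<close>.\<close>
  then obtain y where y: "y \<in> F p" "y \<notin> A" by blast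
  have y2: "y \<in> F (2 * p - 1)" using y(1) F_mono[of p "2 * p - 1"] p_less by auto
  have yc: "y \<in> carrier G" using y2 F_subset p_less by blast
  have U1: "power_cosets G A y 1 = A"
    using subgroup.mem_carrier[OF A] by (force simp: power_cosets_def)
  have T: "radix_type ns (length ns) (k * p - 1) (2 * p - 1) = Suc k * p - 1" if "0 < k" "k < n" for k
  proof -
    have "k * p - 1 < P (Suc s)" "2 * p - 1 < P (Suc s)"
      using np p mult_le_mono1[of k n p] mult_le_mono1[of 2 n p] that n
      by (auto simp: less_eq_Suc_le[symmetric] intro: diff_less le_less_trans)
    then show ?thesis
      using radix_type_level[OF ns, of "Suc s" "length ns"] radix_type_blocks[OF ns s, of k] s that
      unfolding p_def n_def by simp
  qed
  \<comment> \<open>The instance \<open>k = 1\<close> yields the description of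
    \<open>F (2 * p - 1)\<close> that all later instances use, hence the disjunction
    \<open>two\<close>.\<close>
  have next_block: "F (Suc k * p - 1) = power_cosets G A y (Suc k)"
    if k: "0 < k" "k < n" and Uk: "F (k * p - 1) = power_cosets G A y k"
      and two: "k = 1 \<or> F (2 * p - 1) = power_cosets G A y 2" for k
  proof -
    have ltk: "k * p - 1 < order G" "Suc k * p - 1 < order G"
      using lt[of k] lt[of "Suc k"] k by simp_all
    have sub: "F (k * p - 1) <#> F (2 * p - 1) \<subseteq> F (Suc k * p - 1)"
      using F_mult_subset[OF ltk(1) p_less(2)] T[OF k] by simp
    have "power_cosets G A y (Suc k) \<subseteq> F (k * p - 1) <#> F (2 * p - 1)"
    proof
      fix z assume "z \<in> power_cosets G A y (Suc k)"
      then obtain a c where ac: "a \<in> A" "c < Suc k" "z = a \<otimes> y [^] c"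
        by (auto simp: power_cosets_def)
      note acar = subgroup.mem_carrier[OF A ac(1)]
      show "z \<in> F (k * p - 1) <#> F (2 * p - 1)"
      proof (cases c)
        case 0
        then have "z = a \<otimes> \<one>" "a \<in> power_cosets G A y k"
          using ac acar k by (auto simp: power_cosets_def intro!: exI[of _ a] exI[of _ "0::nat"])
        then show ?thesis using one_F[OF p_less(2)] Uk by (auto simp: set_mult_def)
      next
        case (Suc d)
        then have "z = (a \<otimes> y [^] d) \<otimes> y" "a \<otimes> y [^] d \<in> power_cosets G A y k"
          using ac acar yc by (auto simp: power_cosets_def m_assoc)
        then show ?thesis using y2 Uk by (auto simp: set_mult_def)
      qed
    qed
    with sub have subU: "power_cosets G A y (Suc k) \<subseteq> F (Suc k * p - 1)" by blast
    have notin: "y [^] k \<notin> power_cosets G A y k"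
    proof
      assume yk: "y [^] k \<in> power_cosets G A y k"
      show False
      proof (cases "k = 1")
        case True
        then show False using yk y(2) U1 yc by simp
      next
        case False
        \<comment> \<open>The product involves exponents up to \<open>k\<close>, and
          \<open>y [^] k\<close> is already absorbed, so nothing new arises; the prescribed type
          value would then be too large.\<close>
        have "F (k * p - 1) <#> F (2 * p - 1) \<subseteq> F (k * p - 1)"
        proof -
          have "u \<otimes> v \<in> power_cosets G A y k"
            if "u \<in> power_cosets G A y k" "v \<in> power_cosets G A y 2" for u v
            using power_cosets_mult[OF A yc that] power_cosets_Suc_absorb[OF A yc yk] by simp
          then show ?thesis using False two Uk by (auto simp: set_mult_def)
        qed
        then have "Suc k * p - 1 \<le> k * p - 1"
          using radix_type_le[OF ltk(1) p_less(2) ltk(1)] T[OF k] by simp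
        moreover have "k * p - 1 < Suc k * p - 1" using k p by (cases k) simp_all
        ultimately show False by simp
      qed
    qed
    \<comment> \<open>The inclusion \<open>subU\<close> becomes an equality because both sides have
      \<open>Suc k * p\<close> elements.\<close>
    have "card (power_cosets G A y (Suc k)) = card (F (k * p - 1)) + p"
      using card_power_cosets_Suc[OF A fin yc notin] Uk card_A by simp
    also have "\<dots> = card (F (Suc k * p - 1))"
      using card_F[OF ltk(1)] card_F[OF ltk(2)] k p by simp
    finally show ?thesis
      using card_subset_eq[OF finite_F[OF ltk(2)] subU] by simp
  qed
  have F2: "F (2 * p - 1) = power_cosets G A y 2"
    using next_block[of 1] n U1 AF by (simp add: numeral_2_eq_2)
  have "F (k * p - 1) = power_cosets G A y k" if "1 \<le> k" "k \<le> n" for k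
    using that
  proof (induction k rule: dec_induct)
    case base
    then show ?case using U1 AF by simp
  next
    case (step k)
    then show ?case using next_block[of k] F2 by simp
  qed
  from this[of n] have "layer (Suc s) = power_cosets G A y n"
    using n by (simp add: layer_def flip: np)
  moreover have "y \<in> layer (Suc s)"
  proof -
    have "2 * p - 1 \<le> n * p - 1"
      using n by (intro diff_le_mono mult_le_mono1) simp
    then show ?thesis
      unfolding layer_def np[symmetric] using F_mono lt[of n] n y2 by auto
  qed
  ultimately show ?thesis using that unfolding A_def n_def by blast
qed

text \<open>The order of each quotient follows from Lagrange, as successive layers have sizes
  \<open>P s\<close> and \<open>ns ! s * P s\<close>.\<close>

lemma cyclic_filtration_layer: "cyclic_filtration G ns layer"
proof -
  have "layer s \<subset> layer (Suc s) \<and> cyclic_group (G\<lparr>carrier := layer (Suc s)\<rparr> Mod layer s) \<and>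
      order (G\<lparr>carrier := layer (Suc s)\<rparr> Mod layer s) = ns ! s" if s: "s < length ns" for s
  proof -
    have n: "1 < ns ! s" using ns nth_mem[OF s] by blast
    have A: "subgroup (layer s) G" "subgroup (layer (Suc s)) G" using subgroup_layer s by auto
    have PS: "P (Suc s) = ns ! s * P s" using s by (simp add: prod_list_take_Suc)
    have less: "P s < P (Suc s)" using n P_pos[of s] PS by simp
    have sub: "layer s \<subseteq> layer (Suc s)"
      unfolding layer_def using F_mono layer_index_less[of "Suc s"] s less by simp
    moreover have "layer s \<noteq> layer (Suc s)" using card_layer[of s] card_layer[of "Suc s"] s less by auto
    moreover obtain y where "y \<in> layer (Suc s)" "layer (Suc s) = power_cosets G (layer s) y (ns ! s)"
      using layer_Suc_eq_power_cosets[OF s] .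
    then have "cyclic_group (G\<lparr>carrier := layer (Suc s)\<rparr> Mod layer s)"
      using cyclic_FactGroupI[OF A sub] by blast
    moreover have "order (G\<lparr>carrier := layer (Suc s)\<rparr> Mod layer s) = ns ! s"
      using order_FactGroup_subgroup[OF A sub] card_layer[of s] card_layer[of "Suc s"] s PS P_pos[of s]
      by simp
    ultimately show ?thesis by blast
  qed
  then show ?thesis
    using flag subgroup_layer ord by (simp add: cyclic_filtration_def layer_def flag_def)
qed

end

theorem theorem1p8:
  fixes G :: "('a, 'b) monoid_scheme" and ns :: "nat list" and e :: "nat \<Rightarrow> int"
  assumes "comm_group G" and "finite (carrier G)"
    and "tower_type (order G) ns"
    and "tower_gens ns e"
  shows "realizable G (tower_flag_type ns e) \<longleftrightarrow> (\<exists>S. cyclic_filtration G ns S)"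
proof -
  interpret comm_group G by fact
  \<comment> \<open>Realizability compares flag types only at indices below \<open>order G\<close>,
    where the tower type agrees with \<open>radix_type\<close>.\<close>
  have eq: "realizable G (tower_flag_type ns e) \<longleftrightarrow> realizable G (radix_type ns (length ns))"
    using tower_flag_type_eq_radix_type[OF assms(3,4)] by (simp add: realizable_def)
  show ?thesis
    unfolding eq
  proof
    assume "realizable G (radix_type ns (length ns))"
    then obtain F where "radix_flag G ns F"
      using assms(1-3) unfolding realizable_def radix_flag_def radix_flag_axioms_def by blast
    then show "\<exists>S. cyclic_filtration G ns S"
      using radix_flag.cyclic_filtration_layer by blast
  qed (use cyclic_filtration_imp_realizable[OF assms(3)] in blast)
qed

end
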